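(* The geometric dilation of any (simple, not necessarily convex) polygon $C$ with $n$ sides satisfies $$\delta(C)\ge n\tan\frac{\pi}{2n}.$$
   Context: A polygon is regarded as the closed curve formed by its boundary. The geometric dilation of a simple closed curve $C$ is $\delta(C)=\sup_{p\neq q\in C} d_C(p,q)/|pq|$, where $d_C(p,q)$ is the length of the shorter arc of $C$ between $p$ and $q$ and $|pq|$ is the Euclidean distance. *)

theory Defs
  imports "HOL-Analysis.Analysis"
begin

text \<open>The length of a path is the supremum of the lengths of its inscribed polygonal chains;
  it may be infinite.\<close>

definition curve_length :: "(real \<Rightarrow> 'a::metric_space) \<Rightarrow> ereal" where
  "curve_length g =
     Sup {ereal (\<Sum>i<k. dist (g (t i)) (g (t (Suc i)))) | (k::nat) (t::nat \<Rightarrow> real).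
            (\<forall>i\<le>k. t i \<in> {0..1}) \<and> (\<forall>i<k. t i \<le> t (Suc i))}"

text \<open>If \<open>C\<close> is (the image of) a simple closed curve and \<open>p\<close>, \<open>q\<close> are distinct points of \<open>C\<close>,
  then exactly two subsets of \<open>C\<close> are arcs with endpoints \<open>p\<close> and \<open>q\<close>. The length of an arc
  does not depend on its parametrization, so the infimum below is the minimum of two values.\<close>

definition shorter_arc_length :: "'a::metric_space set \<Rightarrow> 'a \<Rightarrow> 'a \<Rightarrow> ereal" where
  "shorter_arc_length C p q =
     (INF h \<in> {h. arc h \<and> path_image h \<subseteq> C \<and> pathstart h = p \<and> pathfinish h = q}.
        curve_length h)"

definition geometric_dilation :: "'a::metric_space set \<Rightarrow> ereal" where
  "geometric_dilation C =
     Sup {shorter_arc_length C p q / ereal (dist p q) | p q. p \<in> C \<and> q \<in> C \<and> p \<noteq> q}"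

text \<open>A polygon with \<open>n\<close> sides is given by its vertices \<open>v 0, \<dots>, v (n - 1)\<close> in cyclic order;
  the values of \<open>v\<close> outside \<open>{..<n}\<close> are irrelevant.\<close>

definition polygon_side :: "nat \<Rightarrow> (nat \<Rightarrow> real^2) \<Rightarrow> nat \<Rightarrow> (real^2) set" where
  "polygon_side n v i = closed_segment (v i) (v (Suc i mod n))"

definition polygon_curve :: "nat \<Rightarrow> (nat \<Rightarrow> real^2) \<Rightarrow> (real^2) set" where
  "polygon_curve n v = (\<Union>i<n. polygon_side n v i)"

text \<open>Two different sides meet only in common endpoints: neighbouring sides share exactly their
  common vertex, all other pairs of sides are disjoint. Angles equal to \<open>\<pi>\<close> are permitted.\<close>

definition simple_polygon :: "nat \<Rightarrow> (nat \<Rightarrow> real^2) \<Rightarrow> bool" where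
  "simple_polygon n v \<longleftrightarrow>
     n \<ge> 3 \<and> inj_on v {..<n} \<and>
     (\<forall>i<n. \<forall>j<n. i \<noteq> j \<longrightarrow>
        polygon_side n v i \<inter> polygon_side n v j
          = {v i, v (Suc i mod n)} \<inter> {v j, v (Suc j mod n)})"

end

theory Submission
  imports Defs
begin

text \<open>Let \<open>c\<close> be the parametrization by arc length and \<open>L\<close> the perimeter. A path in the
  polygon between the antipodal points \<open>c t\<close> and \<open>c (t + L/2)\<close> has length at least \<open>L/2\<close>,
  because the intrinsic distance from \<open>c t\<close> is 1-Lipschitz on every side. Hence
  \<open>L/2 \<le> \<delta> h\<close>, where \<open>h\<close> is the least distance of antipodal points. The difference
  \<open>c t - c (t + L/2)\<close> runs, for \<open>t\<close> from \<open>0\<close> to \<open>L/2\<close>, through at most \<open>n\<close> segments outside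
  the open disc of radius \<open>h\<close>, from a point to its negative, at speed at most 2. A segment seen
  from the origin under the angle \<open>\<theta>\<close> has length at least \<open>2 h tan (\<theta>/2)\<close>, the angles add up
  to at least \<open>\<pi>\<close>, and \<open>tan\<close> is convex, so \<open>L \<ge> 2 h n tan (\<pi>/(2 n))\<close>.\<close>

section \<open>Convexity of the tangent\<close>

text \<open>The mean value theorem applies: the derivative \<open>1 + (tan t)\<^sup>2\<close>
  increases on \<open>[0, pi/2)\<close>, so it bounds the secant slope on either side of
  \<open>y\<close>.\<close>

lemma tan_above_tangent:
  fixes x y :: real
  assumes "0 \<le> x" "x < pi/2" "0 \<le> y" "y < pi/2"
  shows "tan x \<ge> tan y + (1 + (tan y)\<^sup>2) * (x - y)"
proof -
  have D: "(tan has_real_derivative (1 + (tan t)\<^sup>2)) (at t)" if "0 \<le> t" "t < pi/2" for t :: real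
  proof -
    have "cos t > 0" using that by (intro cos_gt_zero_pi) auto
    then have "inverse ((cos t)\<^sup>2) = 1 + (tan t)\<^sup>2"
      using tan_sec[of t] by (simp add: power_inverse)
    with \<open>cos t > 0\<close> show ?thesis using DERIV_tan[of t] by simp
  qed
  have mono: "(tan s)\<^sup>2 \<le> (tan t)\<^sup>2" if "0 \<le> s" "s \<le> t" "t < pi/2" for s t :: real
    using that by (intro power_mono tan_mono_le tan_pos_pi2_le) auto
  show ?thesis
  proof (cases x y rule: linorder_cases)
    case less
    obtain z where z: "z > x" "z < y" "tan y - tan x = (y - x) * (1 + (tan z)\<^sup>2)"
      using MVT2[OF less, of tan "\<lambda>t. 1 + (tan t)\<^sup>2"] D assms by fastforce
    have "(y - x) * (1 + (tan z)\<^sup>2) \<le> (y - x) * (1 + (tan y)\<^sup>2)"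
      using mono[of z y] z less assms by (intro mult_left_mono) auto
    then show ?thesis using z(3) by (simp add: algebra_simps)
  next
    case greater
    obtain z where z: "z > y" "z < x" "tan x - tan y = (x - y) * (1 + (tan z)\<^sup>2)"
      using MVT2[OF greater, of tan "\<lambda>t. 1 + (tan t)\<^sup>2"] D assms by fastforce
    have "(x - y) * (1 + (tan y)\<^sup>2) \<le> (x - y) * (1 + (tan z)\<^sup>2)"
      using mono[of y z] z greater assms by (intro mult_left_mono) auto
    then show ?thesis using z(3) by (simp add: algebra_simps)
  qed auto
qed

text \<open>Jensen's inequality, obtained by summing the tangent line at
  \<open>pi / (2 * real n)\<close>. Its slope is positive, so a sum beyond \<open>pi/2\<close> only
  helps; \<open>n \<ge> 2\<close> keeps the point of tangency below \<open>pi/2\<close>.\<close>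

lemma sum_tan_ge:
  fixes x :: "nat \<Rightarrow> real"
  assumes "n \<ge> 2" and x: "\<And>j. j < n \<Longrightarrow> 0 \<le> x j \<and> x j < pi/2"
    and sum: "(\<Sum>j<n. x j) \<ge> pi/2"
  shows "(\<Sum>j<n. tan (x j)) \<ge> real n * tan (pi / (2 * real n))"
proof -
  let ?y = "pi / (2 * real n)"
  have y: "0 \<le> ?y" "?y < pi/2" using assms(1) by (auto simp: field_simps)
  have "real n * tan ?y + (1 + (tan ?y)\<^sup>2) * ((\<Sum>j<n. x j) - real n * ?y)
      = (\<Sum>j<n. tan ?y + (1 + (tan ?y)\<^sup>2) * (x j - ?y))"
    by (simp add: sum.distrib sum_distrib_left[symmetric] sum_subtractf)
  also have "\<dots> \<le> (\<Sum>j<n. tan (x j))"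
    using x y by (intro sum_mono tan_above_tangent) auto
  finally have *: "real n * tan ?y + (1 + (tan ?y)\<^sup>2) * ((\<Sum>j<n. x j) - real n * ?y)
      \<le> (\<Sum>j<n. tan (x j))" .
  have "real n * ?y = pi/2" using assms(1) by simp
  then have "(1 + (tan ?y)\<^sup>2) * ((\<Sum>j<n. x j) - real n * ?y) \<ge> 0"
    using sum by (intro mult_nonneg_nonneg) auto
  with * show ?thesis by linarith
qed

section \<open>Segments and chains outside a disc around the origin\<close>

text \<open>Among segments seen under a fixed angle, with a fixed length of the angle bisector, the
  isosceles position is the shortest. The bisector ends on the segment, hence is at least
  \<open>h\<close> long. An angle of \<open>pi\<close> would put the origin on the segment.\<close>

lemma segment_length_ge_tan:
  fixes a b :: complex
  assumes h: "h > 0" and seg: "\<And>w. w \<in> closed_segment a b \<Longrightarrow> h \<le> norm w"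
  shows "\<bar>Arg (b/a)\<bar> < pi" and "2 * h * tan (\<bar>Arg (b/a)\<bar> / 2) \<le> dist a b"
proof -
  define A B t where "A = norm a" and "B = norm b" and "t = \<bar>Arg (b/a)\<bar> / 2"
  have "h \<le> A" "h \<le> B" unfolding A_def B_def by (auto intro: seg)
  with h have pos: "A > 0" "B > 0" by auto
  then have nz: "a \<noteq> 0" "b \<noteq> 0" by (auto simp: A_def B_def)
  have "cos (Arg (b/a)) = cos (2 * t)" by (simp add: t_def abs_if)
  moreover have "Re (b/a) = norm (b/a) * cos (Arg (b/a))"
    using rcis_cmod_Arg[of "b/a"] by (metis Re_rcis)
  ultimately have re: "Re (b/a) = B / A * cos (2 * t)" by (simp add: A_def B_def norm_divide)
  have inner: "a \<bullet> b = A * B * cos (2 * t)"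
  proof -
    have "a \<bullet> (a * q) = (norm a)\<^sup>2 * Re q" for q
      unfolding cmod_power2 by (simp add: inner_complex_def algebra_simps power2_eq_square)
    from this[of "b/a"] have "a \<bullet> b = A\<^sup>2 * Re (b/a)"
      using nz by (simp add: A_def)
    then show ?thesis using re pos by (simp add: power2_eq_square)
  qed
  \<comment> \<open>the point in which the angle bisector at the origin meets the segment\<close>
  define m where "m = (B / (A + B)) *\<^sub>R a + (A / (A + B)) *\<^sub>R b"
  have "B / (A + B) = 1 - A / (A + B)" "0 \<le> A / (A + B)" "A / (A + B) \<le> 1"
    using pos by (auto simp: field_simps)
  then have "m \<in> closed_segment a b"
    unfolding closed_segment_def m_def by auto
  then have hm: "h \<le> norm m" by (rule seg)
  \<comment> \<open>Squaring leads to the bisector formula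
    \<open>norm m = 2 * A * B * cos t / (A + B)\<close>.\<close>
  have "(A + B)\<^sup>2 * (norm m)\<^sup>2 = (norm (B *\<^sub>R a + A *\<^sub>R b))\<^sup>2"
  proof -
    have "(A + B) *\<^sub>R m = B *\<^sub>R a + A *\<^sub>R b"
      using pos by (simp add: m_def scaleR_add_right)
    moreover have "norm ((A + B) *\<^sub>R m) = (A + B) * norm m" using pos by simp
    ultimately show ?thesis by (metis power_mult_distrib)
  qed
  also have "\<dots> = B\<^sup>2 * (a \<bullet> a) + 2 * A * B * (a \<bullet> b) + A\<^sup>2 * (b \<bullet> b)"
    unfolding power2_norm_eq_inner
    by (simp add: inner_add_left inner_add_right inner_commute[of b a] algebra_simps power2_eq_square)
  also have "\<dots> = (2 * A * B * cos t)\<^sup>2"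
    unfolding inner cos_double_cos
    by (simp add: A_def B_def power2_norm_eq_inner[symmetric] algebra_simps power2_eq_square)
  finally have m2: "((A + B) * norm m)\<^sup>2 = (2 * A * B * cos t)\<^sup>2" by (simp add: power_mult_distrib)
  have t: "0 \<le> t" "t \<le> pi/2" using Arg_bounded[of "b/a"] by (auto simp: t_def)
  then have ct: "cos t \<ge> 0" by (intro cos_ge_zero) auto
  have m: "(A + B) * norm m = 2 * A * B * cos t"
    using m2 by (rule power2_eq_imp_eq) (use ct pos in auto)
  have "norm m > 0" using hm h by linarith
  then have "(A + B) * norm m \<noteq> 0" using pos by simp
  then have cpos: "cos t > 0" using m ct by (cases "cos t = 0") auto
  then have "t \<noteq> pi/2" using cos_pi_half by force
  then show "\<bar>Arg (b/a)\<bar> < pi" using t by (auto simp: t_def)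
  have st: "sin t \<ge> 0" using t by (intro sin_ge_zero) auto
  have d2: "(dist a b)\<^sup>2 = (A - B)\<^sup>2 + 4 * A * B * (sin t)\<^sup>2"
  proof -
    have "(dist a b)\<^sup>2 = A\<^sup>2 + B\<^sup>2 - 2 * (a \<bullet> b)"
      by (simp add: dist_norm power2_norm_eq_inner inner_diff_left inner_diff_right A_def B_def
          inner_commute[of b a])
    then show ?thesis unfolding inner cos_double_sin by (simp add: algebra_simps power2_eq_square)
  qed
  \<comment> \<open>The inequality of arithmetic and geometric means for \<open>A\<close> and
    \<open>B\<close>; equality is the isosceles case.\<close>
  have "(4 * A * B * sin t)\<^sup>2 \<le> (dist a b * (A + B))\<^sup>2"
  proof -
    have "4 * A * B \<le> (A + B)\<^sup>2"
      using zero_le_power2[of "A - B"] by (simp add: power2_eq_square algebra_simps)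
    then have "4 * A * B * (sin t)\<^sup>2 * (4 * A * B) \<le> 4 * A * B * (sin t)\<^sup>2 * (A + B)\<^sup>2"
      using pos by (intro mult_left_mono) auto
    also have "\<dots> \<le> (dist a b)\<^sup>2 * (A + B)\<^sup>2"
      unfolding d2 by (intro mult_right_mono) auto
    finally show ?thesis by (simp add: power_mult_distrib power2_eq_square mult_ac)
  qed
  then have le: "4 * A * B * sin t \<le> dist a b * (A + B)"
    by (rule power2_le_imp_le) (use pos in auto)
  have "2 * norm m * tan t * (A + B) = 2 * ((A + B) * norm m) * tan t" by (simp add: mult_ac)
  also have "\<dots> = 4 * A * B * sin t" unfolding m using cpos by (simp add: tan_def)
  finally have "2 * norm m * tan t * (A + B) \<le> dist a b * (A + B)" using le by simp
  then have "2 * norm m * tan t \<le> dist a b" using pos by (simp add: mult_le_cancel_right)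
  moreover have "2 * h * tan t \<le> 2 * norm m * tan t"
    using hm st cpos by (intro mult_right_mono) (auto simp: tan_def)
  ultimately show "2 * h * tan (\<bar>Arg (b/a)\<bar> / 2) \<le> dist a b" by (simp add: t_def)
qed

text \<open>The principal arguments of the successive quotients add up to an argument of
  \<open>z n / z 0 = -1\<close>, so their absolute values add up to at least \<open>pi\<close>. The
  bound for single segments and the convexity of \<open>tan\<close> do the rest.\<close>

lemma half_turn_length_ge:
  fixes z :: "nat \<Rightarrow> complex"
  assumes "n \<ge> 2" and h: "h > 0"
    and seg: "\<And>j w. j < n \<Longrightarrow> w \<in> closed_segment (z j) (z (Suc j)) \<Longrightarrow> h \<le> norm w"
    and opp: "z n = - z 0"
  shows "2 * h * (real n * tan (pi / (2 * real n))) \<le> (\<Sum>j<n. dist (z j) (z (Suc j)))"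
proof -
  define a where "a j = Arg (z (Suc j) / z j)" for j
  have nz: "z j \<noteq> 0" if "j \<le> n" for j
  proof (cases "j = n")
    case True
    then show ?thesis using seg[of "n - 1" "z n"] h assms(1) by auto
  next
    case False
    then show ?thesis using seg[of j "z j"] h that by auto
  qed
  \<comment> \<open>The sum need not be a principal argument, hence the statement through
    \<open>cis\<close> and not through \<open>Arg\<close>.\<close>
  have turn: "z k / z 0 = of_real (norm (z k) / norm (z 0)) * cis (\<Sum>j<k. a j)" if "k \<le> n" for k
    using that
  proof (induction k)
    case 0
    then show ?case using nz[of 0] by simp
  next
    case (Suc k)
    have "z (Suc k) / z 0 = (z (Suc k) / z k) * (z k / z 0)"
      using nz[of k] Suc.prems by simp
    also have "z (Suc k) / z k = of_real (norm (z (Suc k)) / norm (z k)) * cis (a k)"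
      using rcis_cmod_Arg[of "z (Suc k) / z k"] by (simp add: rcis_def a_def norm_divide)
    finally show ?case
      using Suc nz[of k] by (simp add: cis_mult[symmetric] mult_ac)
  qed
  have "cis (\<Sum>j<n. a j) = -1"
    using turn[of n] nz[of 0] opp by simp
  then have c: "cos (\<Sum>j<n. a j) = -1" by (simp add: complex_eq_iff)
  have "\<bar>\<Sum>j<n. a j\<bar> \<ge> pi"
  proof (rule ccontr)
    assume "\<not> ?thesis"
    then have "cos pi < cos \<bar>\<Sum>j<n. a j\<bar>" by (intro cos_monotone_0_pi) auto
    with c show False by simp
  qed
  then have s: "(\<Sum>j<n. \<bar>a j\<bar> / 2) \<ge> pi/2"
    using order_trans[OF _ sum_abs, of pi a "{..<n}"] by (simp add: sum_divide_distrib[symmetric])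
  have "2 * h * (real n * tan (pi / (2 * real n))) \<le> 2 * h * (\<Sum>j<n. tan (\<bar>a j\<bar> / 2))"
    using segment_length_ge_tan(1)[OF h seg] s assms(1) h
    by (intro mult_left_mono sum_tan_ge) (auto simp: a_def)
  also have "\<dots> = (\<Sum>j<n. 2 * h * tan (\<bar>a j\<bar> / 2))" by (simp add: sum_distrib_left)
  also have "\<dots> \<le> (\<Sum>j<n. dist (z j) (z (Suc j)))"
    using segment_length_ge_tan(2)[OF h seg] by (intro sum_mono) (auto simp: a_def)
  finally show ?thesis .
qed

text \<open>Transfer along a linear isometry to the complex plane, where arguments are
  available.\<close>

lemma half_turn_length_ge_real2:
  fixes z :: "nat \<Rightarrow> real^2"
  assumes "n \<ge> 2" and "h > 0"
    and seg: "\<And>j w. j < n \<Longrightarrow> w \<in> closed_segment (z j) (z (Suc j)) \<Longrightarrow> h \<le> norm w"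
    and opp: "z n = - z 0"
  shows "2 * h * (real n * tan (pi / (2 * real n))) \<le> (\<Sum>j<n. dist (z j) (z (Suc j)))"
proof -
  define g :: "real^2 \<Rightarrow> complex" where "g x = Complex (x $ 1) (x $ 2)" for x
  have lin: "linear g" by (rule linearI) (auto simp: g_def complex_eq_iff)
  have nrm: "norm (g x) = norm x" for x
    by (simp add: g_def cmod_def norm_vec_def L2_set_def sum_2)
  have dst: "dist (g x) (g y) = dist x y" for x y
    by (simp add: dist_norm nrm linear_diff[OF lin, symmetric])
  have "2 * h * (real n * tan (pi / (2 * real n))) \<le> (\<Sum>j<n. dist (g (z j)) (g (z (Suc j))))"
  proof (rule half_turn_length_ge)
    fix j w assume "j < n" "w \<in> closed_segment (g (z j)) (g (z (Suc j)))"
    then show "h \<le> norm w"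
      using seg by (auto simp: closed_segment_linear_image[OF lin] nrm)
  qed (use assms linear_neg[OF lin] in auto)
  then show ?thesis by (simp add: dst)
qed

section \<open>Lower bounds for the length of a path\<close>

text \<open>Greedy elimination: jump from the starting point to the last visit of a piece that contains
  it; afterwards that piece is never needed again.\<close>

lemma chain_length_ge_potential:
  fixes h :: "real \<Rightarrow> 'a::metric_space" and f :: "'a \<Rightarrow> real"
  assumes "finite F" "\<And>X. X \<in> F \<Longrightarrow> closed X"
    and "\<And>X x y. X \<in> F \<Longrightarrow> x \<in> X \<Longrightarrow> y \<in> X \<Longrightarrow> f y - f x \<le> dist x y"
    and "a \<le> b" "continuous_on {a..b} h" "h ` {a..b} \<subseteq> \<Union>F"
  shows "\<exists>(k::nat) t. t 0 = a \<and> t k = b \<and> (\<forall>i<k. t i \<le> t (Suc i)) \<and>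
           f (h b) - f (h a) \<le> (\<Sum>i<k. dist (h (t i)) (h (t (Suc i))))"
  using assms
proof (induction "card F" arbitrary: F a rule: less_induct)
  case less
  have "h a \<in> \<Union>F" using less.prems(4,6) by (simp add: image_subset_iff)
  then obtain X where X: "X \<in> F" "h a \<in> X" by blast
  define T where "T = {a..b} \<inter> h -` X"
  have "closed T" unfolding T_def
    by (rule continuous_closed_preimage) (use less.prems X in auto)
  moreover have "T \<noteq> {}" "bdd_above T" using X less.prems(4) by (auto simp: T_def)
  ultimately have "Sup T \<in> T" by (intro closed_contains_Sup) auto
  then obtain m where m: "m \<in> T" "m = Sup T" by blast
  have last: "t \<le> m" if "t \<in> {a..b}" "h t \<in> X" for t
    unfolding m by (rule cSup_upper) (use that \<open>bdd_above T\<close> in \<open>auto simp: T_def\<close>)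
  have mab: "a \<le> m" "m \<le> b" "h m \<in> X" using m(1) by (auto simp: T_def)
  have jump: "f (h m) - f (h a) \<le> dist (h a) (h m)" using less.prems(3)[OF X(1,2) mab(3)] .
  show ?case
  proof (cases "m = b")
    case True
    then show ?thesis using jump mab
      by (intro exI[of _ 1] exI[of _ "\<lambda>i::nat. if i = 0 then a else b"]) auto
  next
    case False
    with mab have "m < b" by auto
    have cont: "continuous_on {m..b} h"
      using less.prems(5) by (rule continuous_on_subset) (use mab in auto)
    have "h ` {m<..b} \<subseteq> \<Union>(F - {X})"
    proof (rule image_subsetI)
      fix t assume t: "t \<in> {m<..b}"
      then have "t \<in> {a..b}" using mab by auto
      moreover from this have "h t \<notin> X" using last[of t] t by auto
      ultimately show "h t \<in> \<Union>(F - {X})" using less.prems(6) by blast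
    qed
    \<comment> \<open>After time \<open>m\<close> the path avoids \<open>X\<close>. At
      \<open>m\<close> itself it lies in the union of the other pieces, because that union is closed
      and \<open>m\<close> is a limit of later times.\<close>
    moreover have "closed (\<Union>(F - {X}))" using less.prems(1,2) by (intro closed_Union) auto
    ultimately have sub: "h ` {m..b} \<subseteq> \<Union>(F - {X})"
      using image_closure_subset[of "{m<..b}" h "\<Union>(F - {X})"] cont \<open>m < b\<close> by simp
    have "card (F - {X}) < card F" using less.prems(1) X(1) by (rule card_Diff1_less)
    then have "\<exists>(k::nat) t. t 0 = m \<and> t k = b \<and> (\<forall>i<k. t i \<le> t (Suc i)) \<and>
        f (h b) - f (h m) \<le> (\<Sum>i<k. dist (h (t i)) (h (t (Suc i))))"
      using less.prems(1-3) mab(2) cont sub by (intro less.hyps) auto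
    then obtain k :: nat and t where t: "t 0 = m" "t k = b" "\<forall>i<k. t i \<le> t (Suc i)"
      "f (h b) - f (h m) \<le> (\<Sum>i<k. dist (h (t i)) (h (t (Suc i))))"
      by (elim exE conjE)
    show ?thesis
    proof (intro exI conjI)
      let ?t = "case_nat a t"
      show "?t 0 = a" "?t (Suc k) = b" using t by auto
      show "\<forall>i<Suc k. ?t i \<le> ?t (Suc i)" using t mab by (auto split: nat.split)
      show "f (h b) - f (h a) \<le> (\<Sum>i<Suc k. dist (h (?t i)) (h (?t (Suc i))))"
        using t jump by (simp add: sum.lessThan_Suc_shift del: sum.lessThan_Suc)
    qed
  qed
qed

text \<open>The sample points found on \<open>{0..1}\<close> form one of the inscribed chains whose
  supremum is the length.\<close>

lemma curve_length_ge_potential: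
  fixes h :: "real \<Rightarrow> 'a::metric_space" and f :: "'a \<Rightarrow> real"
  assumes "finite F" "\<And>X. X \<in> F \<Longrightarrow> closed X"
    and "\<And>X x y. X \<in> F \<Longrightarrow> x \<in> X \<Longrightarrow> y \<in> X \<Longrightarrow> f y - f x \<le> dist x y"
    and "path h" "path_image h \<subseteq> \<Union>F"
  shows "ereal (f (pathfinish h) - f (pathstart h)) \<le> curve_length h"
proof -
  have "continuous_on {0..1} h" "h ` {0..1} \<subseteq> \<Union>F"
    using assms(4,5) by (auto simp: path_def path_image_def)
  then have "\<exists>(k::nat) t. t 0 = 0 \<and> t k = 1 \<and> (\<forall>i<k. t i \<le> t (Suc i)) \<and>
      f (h 1) - f (h 0) \<le> (\<Sum>i<k. dist (h (t i)) (h (t (Suc i))))"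
    using assms(1-3) by (intro chain_length_ge_potential) auto
  then obtain k :: nat and t where t: "t 0 = 0" "t k = 1" "\<forall>i<k. t i \<le> t (Suc i)"
    "f (h 1) - f (h 0) \<le> (\<Sum>i<k. dist (h (t i)) (h (t (Suc i))))" by (elim exE conjE)
  have mono: "t i \<le> t j" if "i \<le> j" "j \<le> k" for i j
    using that by (induction j rule: dec_induct) (use t(3) in \<open>auto intro: order_trans\<close>)
  have "t i \<in> {0..1}" if "i \<le> k" for i
    using mono[of 0 i] mono[of i k] that t(1,2) by auto
  then have "ereal (\<Sum>i<k. dist (h (t i)) (h (t (Suc i)))) \<le> curve_length h"
    unfolding curve_length_def using t(3) by (intro Sup_upper) blast
  moreover have "ereal (f (h 1) - f (h 0)) \<le> ereal (\<Sum>i<k. dist (h (t i)) (h (t (Suc i))))"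
    using t(4) by simp
  ultimately show ?thesis unfolding pathfinish_def pathstart_def by (rule order_trans[rotated])
qed

section \<open>Arc-length parametrization of a simple polygon\<close>

locale simple_polygon_param =
  fixes n :: nat and v :: "nat \<Rightarrow> real^2"
  assumes simple: "simple_polygon n v"
begin

text \<open>Cyclic indexing: \<open>w n\<close> is \<open>w 0\<close>, so the last side needs no
  special case.\<close>

definition w :: "nat \<Rightarrow> real^2" where "w i = v (i mod n)"

definition l :: "nat \<Rightarrow> real" where "l i = dist (w i) (w (Suc i))"

text \<open>The arc-length parameter of the vertex \<open>w i\<close>.\<close>

definition S :: "nat \<Rightarrow> real" where "S i = (\<Sum>k<i. l k)"

definition L :: real where "L = S n"

text \<open>The parametrization by arc length, starting at the vertex \<open>v 0\<close>.\<close>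

definition c :: "real \<Rightarrow> real^2" where
  "c s = (let i = LEAST i. s \<le> S (Suc i) in w i + ((s - S i) / l i) *\<^sub>R (w (Suc i) - w i))"

lemma n3: "n \<ge> 3"
  using simple by (simp add: simple_polygon_def)

lemma w_eq_iff: "w i = w j \<longleftrightarrow> i mod n = j mod n"
proof -
  have "inj_on v {..<n}" using simple by (simp add: simple_polygon_def)
  then show ?thesis using n3 by (auto simp: w_def inj_on_def)
qed

lemma polygon_side_eq: "i < n \<Longrightarrow> polygon_side n v i = closed_segment (w i) (w (Suc i))"
  by (simp add: polygon_side_def w_def)

lemma sides_inter:
  assumes "i < n" "j < n" "i \<noteq> j"
  shows "closed_segment (w i) (w (Suc i)) \<inter> closed_segment (w j) (w (Suc j))
    = {w i, w (Suc i)} \<inter> {w j, w (Suc j)}"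
proof -
  have "polygon_side n v i \<inter> polygon_side n v j
      = {v i, v (Suc i mod n)} \<inter> {v j, v (Suc j mod n)}"
    using simple assms unfolding simple_polygon_def by blast
  then show ?thesis using assms by (simp add: polygon_side_def w_def)
qed

lemma l_pos: "l i > 0"
proof -
  have "i mod n \<noteq> Suc i mod n"
    using n3 by (auto simp: mod_Suc)
  then show ?thesis by (simp add: l_def w_eq_iff)
qed

lemma S_0: "S 0 = 0" and S_Suc: "S (Suc i) = S i + l i"
  by (simp_all add: S_def)

lemma S_strict_mono: "strict_mono S"
  by (rule strict_monoI_Suc) (simp add: S_Suc l_pos)

lemmas S_less_iff = strict_mono_less[OF S_strict_mono]
lemmas S_le_iff = strict_mono_less_eq[OF S_strict_mono]

lemma S_nonneg: "S i \<ge> 0"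
  using S_le_iff[of 0 i] by (simp add: S_0)

lemma L_pos: "L > 0"
  using S_less_iff[of 0 n] n3 by (simp add: S_0 L_def)

text \<open>The \<open>LEAST\<close> in \<open>c\<close> picks \<open>i\<close>, except at a left
  end \<open>s = S i\<close> with \<open>i > 0\<close>, where it picks the preceding piece; both
  formulas then give \<open>w i\<close>.\<close>

lemma c_piece:
  assumes s: "s \<in> {S i..S (Suc i)}"
  shows "c s = w i + ((s - S i) / l i) *\<^sub>R (w (Suc i) - w i)"
proof (cases "\<exists>j. i = Suc j \<and> s = S i")
  case True
  then obtain j where j: "i = Suc j" "s = S (Suc j)" by auto
  have "(LEAST k. s \<le> S (Suc k)) = j"
    by (rule Least_equality) (auto simp: j S_le_iff)
  then show ?thesis
    using l_pos[of j] by (simp add: c_def Let_def j S_Suc)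
next
  case False
  have "(LEAST k. s \<le> S (Suc k)) = i"
  proof (rule Least_equality)
    show "s \<le> S (Suc i)" using s by simp
  next
    fix k assume k: "s \<le> S (Suc k)"
    show "i \<le> k"
    proof (rule ccontr)
      assume "\<not> i \<le> k"
      then have "S (Suc k) \<le> S i" by (simp add: S_le_iff)
      with s k have "s = S i" "S (Suc k) = S i" by auto
      moreover from this(2) have "Suc k = i" using S_strict_mono by (simp add: strict_mono_eq)
      ultimately show False using False by auto
    qed
  qed
  then show ?thesis by (simp add: c_def Let_def)
qed

lemma c_S: "c (S i) = w i"
  using c_piece[of "S i" i] S_Suc[of i] l_pos[of i] by simp

lemma dist_c_piece:
  assumes "a \<in> {S i..S (Suc i)}" "b \<in> {S i..S (Suc i)}"
  shows "dist (c a) (c b) = \<bar>a - b\<bar>"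
proof -
  have "c a - c b = ((a - b) / l i) *\<^sub>R (w (Suc i) - w i)"
    by (simp add: c_piece[OF assms(1)] c_piece[OF assms(2)] diff_divide_distrib scaleR_diff_left)
  then show ?thesis
    using l_pos[of i] by (simp add: dist_norm l_def norm_minus_commute[of "w i"])
qed

lemma c_piece_affine:
  assumes "a \<in> {S i..S (Suc i)}" "b \<in> {S i..S (Suc i)}" "0 \<le> u" "u \<le> 1"
  shows "c ((1 - u) * a + u * b) = (1 - u) *\<^sub>R c a + u *\<^sub>R c b"
proof -
  have "(1 - u) * a + u * b \<in> {S i..S (Suc i)}"
    using convexD_alt[OF convex_real_interval(5) assms] by simp
  moreover have "((1 - u) * a + u * b - S i) / l i = (1 - u) * ((a - S i) / l i) + u * ((b - S i) / l i)"
    using l_pos[of i] by (simp add: field_simps)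
  ultimately show ?thesis
    using assms by (simp add: c_piece scaleR_add_left scaleR_add_right algebra_simps)
qed

lemma c_image_piece: "c ` {S i..S (Suc i)} = closed_segment (w i) (w (Suc i))"
proof -
  have S_in: "S i \<in> {S i..S (Suc i)}" "S (Suc i) \<in> {S i..S (Suc i)}" by (simp_all add: S_le_iff)
  have "S i \<le> S (Suc i)" by (simp add: S_le_iff)
  then have "{S i..S (Suc i)} = (\<lambda>u. (1 - u) * S i + u * S (Suc i)) ` {0..1}"
    using closed_segment_eq_real_ivl1[of "S i" "S (Suc i)"]
    by (simp add: closed_segment_image_interval)
  then show ?thesis
    using c_piece_affine[OF S_in] by (auto simp: image_image c_S closed_segment_def)
qed

text \<open>For the least \<open>i\<close> with \<open>a < S (Suc i)\<close>, minimality yields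
  \<open>S i \<le> a\<close>, and the absence of a breakpoint yields
  \<open>b \<le> S (Suc i)\<close>. For \<open>a = L\<close> that index would be \<open>n\<close>,
  so the last piece is taken instead.\<close>

lemma common_piece:
  assumes "0 \<le> a" "a \<le> b" "b \<le> L" and no: "\<And>i. i \<le> n \<Longrightarrow> \<not> (a < S i \<and> S i < b)"
  shows "\<exists>i<n. a \<in> {S i..S (Suc i)} \<and> b \<in> {S i..S (Suc i)}"
proof (cases "a = L")
  case True
  then show ?thesis
    using assms n3 by (intro exI[of _ "n - 1"]) (auto simp: L_def S_le_iff)
next
  case False
  define i where "i = (LEAST i. a < S (Suc i))"
  have ex: "a < S (Suc (n - 1))" using False assms n3 by (simp add: L_def)
  then have up: "a < S (Suc i)" unfolding i_def by (rule LeastI)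
  have "i \<le> n - 1" unfolding i_def using ex by (rule Least_le)
  then have "i < n" using n3 by simp
  have low: "S i \<le> a"
  proof (cases i)
    case 0
    then show ?thesis using assms(1) by (simp add: S_0)
  next
    case (Suc k)
    then have "\<not> a < S (Suc k)" unfolding i_def by (intro not_less_Least) simp
    then show ?thesis using Suc by simp
  qed
  have "b \<le> S (Suc i)" using no[of "Suc i"] up \<open>i < n\<close> by simp
  then show ?thesis using low up \<open>i < n\<close> assms(2) by auto
qed

lemma piece_of:
  assumes "s \<in> {0..L}"
  shows "\<exists>i<n. s \<in> {S i..S (Suc i)}"
  using common_piece[of s s] assms by auto

lemma polygon_curve_eq: "polygon_curve n v = c ` {0..L}"
proof -
  have "(\<Union>i<n. {S i..S (Suc i)}) = {0..L}"
  proof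
    show "(\<Union>i<n. {S i..S (Suc i)}) \<subseteq> {0..L}"
    proof (intro UN_least subsetI)
      fix i s assume "i \<in> {..<n}" "s \<in> {S i..S (Suc i)}"
      moreover from this have "S (Suc i) \<le> L" by (simp add: L_def S_le_iff)
      ultimately show "s \<in> {0..L}" using S_nonneg[of i] by auto
    qed
    show "{0..L} \<subseteq> (\<Union>i<n. {S i..S (Suc i)})" using piece_of by blast
  qed
  then show ?thesis
    unfolding polygon_curve_def by (simp add: polygon_side_eq flip: c_image_piece image_UN)
qed

text \<open>On a single side \<open>c\<close> is an isometry. A point on two different sides is a
  vertex of both by simplicity, and a side attains its vertices only at the corresponding ends of
  its parameter interval.\<close>

lemma c_eqD:
  assumes "c s = c t" "s \<in> {0..L}" "t \<in> {0..L}"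
  shows "s = t \<or> s = 0 \<and> t = L \<or> s = L \<and> t = 0"
proof -
  obtain i where i: "i < n" "s \<in> {S i..S (Suc i)}" using piece_of[OF assms(2)] by auto
  obtain j where j: "j < n" "t \<in> {S j..S (Suc j)}" using piece_of[OF assms(3)] by auto
  show ?thesis
  proof (cases "i = j")
    case True
    then show ?thesis using dist_c_piece[OF i(2), of t] j assms(1) by simp
  next
    case False
    have vertex: "x = S k" if "c x = w k" "k \<in> {m, Suc m}" "x \<in> {S m..S (Suc m)}" for x k m
    proof -
      have "S k \<in> {S m..S (Suc m)}" using that(2) by (auto simp: S_le_iff)
      from dist_c_piece[OF that(3) this] show ?thesis using that(1) by (simp add: c_S)
    qed
    have "c s \<in> closed_segment (w i) (w (Suc i)) \<inter> closed_segment (w j) (w (Suc j))"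
      using i j assms(1) unfolding c_image_piece[symmetric] by (metis IntI imageI)
    then have "c s \<in> {w i, w (Suc i)}" "c s \<in> {w j, w (Suc j)}"
      using sides_inter[OF i(1) j(1) False] by auto
    then obtain a b where ab: "a \<in> {i, Suc i}" "c s = w a" "b \<in> {j, Suc j}" "c s = w b" by blast
    then have "s = S a" "t = S b" using vertex[of s a i] vertex[of t b j] i j assms(1) by auto
    moreover have "a mod n = b mod n" using ab by (simp add: w_eq_iff[symmetric])
    moreover have "a \<le> n" "b \<le> n" using ab i j by auto
    \<comment> \<open>Indices up to \<open>n\<close> that agree modulo \<open>n\<close> are equal,
      or one is 0 and the other \<open>n\<close>.\<close>
    ultimately show ?thesis
      by (cases "a = n"; cases "b = n") (auto simp: L_def S_0)
  qed
qed

section \<open>Antipodal points and the dilation\<close>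

lemma antipodal_path_length:
  assumes t: "t \<in> {0..L/2}" and h: "path h" "path_image h \<subseteq> polygon_curve n v"
    and ends: "pathstart h = c t" "pathfinish h = c (t + L/2)"
  shows "ereal (L/2) \<le> curve_length h"
proof -
  \<comment> \<open>Distance from \<open>t\<close> on a circle of circumference
    \<open>L\<close>.\<close>
  define g where "g s = min \<bar>s - t\<bar> (L - \<bar>s - t\<bar>)" for s
  \<comment> \<open>The only ambiguity in the choice of \<open>s\<close> is between 0 and
    \<open>L\<close>, where \<open>g\<close> agrees.\<close>
  define f where "f x = g (SOME s. s \<in> {0..L} \<and> c s = x)" for x
  have f: "f (c s) = g s" if s: "s \<in> {0..L}" for s
  proof -
    define r where "r = (SOME r. r \<in> {0..L} \<and> c r = c s)"
    have "r \<in> {0..L} \<and> c r = c s" unfolding r_def by (rule someI) (use s in auto)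
    then have "r = s \<or> r = 0 \<and> s = L \<or> r = L \<and> s = 0" using s by (intro c_eqD) auto
    moreover have "g 0 = g L" using t L_pos by (auto simp: g_def min_def)
    ultimately show ?thesis unfolding f_def r_def[symmetric] by auto
  qed
  have "ereal (f (pathfinish h) - f (pathstart h)) \<le> curve_length h"
  proof (rule curve_length_ge_potential[where F = "polygon_side n v ` {..<n}"])
    show "closed X" if "X \<in> polygon_side n v ` {..<n}" for X
      using that by (auto simp: polygon_side_def)
    show "f y - f x \<le> dist x y"
      if X: "X \<in> polygon_side n v ` {..<n}" "x \<in> X" "y \<in> X" for X x y
    proof -
      obtain i where i: "i < n" "x \<in> c ` {S i..S (Suc i)}" "y \<in> c ` {S i..S (Suc i)}"
        using X by (auto simp: polygon_side_eq c_image_piece)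
      then obtain r s where rs: "r \<in> {S i..S (Suc i)}" "s \<in> {S i..S (Suc i)}" "x = c r" "y = c s"
        by auto
      have "S (Suc i) \<le> L" using i by (simp add: L_def S_le_iff)
      then have "f x = g r" "f y = g s" using rs S_nonneg[of i] by (auto simp: f)
      moreover have "g s - g r \<le> \<bar>r - s\<bar>" by (auto simp: g_def)
      ultimately show ?thesis using dist_c_piece[OF rs(1,2)] rs by simp
    qed
    show "path_image h \<subseteq> \<Union> (polygon_side n v ` {..<n})" using h by (simp add: polygon_curve_def)
  qed (use h in auto)
  moreover have "g t = 0" "g (t + L/2) = L/2" using L_pos by (auto simp: g_def)
  moreover have "f (c t) = g t" "f (c (t + L/2)) = g (t + L/2)" using t L_pos by (auto intro!: f)
  ultimately show ?thesis by (simp add: ends)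
qed

text \<open>The length bound holds for every arc, hence for the infimum. The parameters
  \<open>t\<close> and \<open>t + L/2\<close> differ by less than \<open>L\<close>, so they are not
  the identified pair 0 and \<open>L\<close>.\<close>

lemma antipodal_quotient_le_dilation:
  assumes t: "t \<in> {0..L/2}"
  shows "ereal (L/2 / dist (c t) (c (t + L/2))) \<le> geometric_dilation (polygon_curve n v)"
    and "c t \<noteq> c (t + L/2)"
proof -
  let ?C = "polygon_curve n v" and ?p = "c t" and ?q = "c (t + L/2)"
  show ne: "?p \<noteq> ?q" using c_eqD[of t "t + L/2"] t L_pos by auto
  have "ereal (L/2) \<le> shorter_arc_length ?C ?p ?q"
    unfolding shorter_arc_length_def
    by (rule INF_greatest) (auto intro!: antipodal_path_length[OF t] simp: arc_imp_path)
  then have "ereal (L/2) / ereal (dist ?p ?q) \<le> shorter_arc_length ?C ?p ?q / ereal (dist ?p ?q)"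
    using ne by (intro ereal_divide_right_mono) auto
  also have "\<dots> \<le> geometric_dilation ?C"
  proof -
    have "?p \<in> ?C" "?q \<in> ?C" using t by (auto simp: polygon_curve_eq)
    then show ?thesis unfolding geometric_dilation_def using ne by (intro Sup_upper) blast
  qed
  finally show "ereal (L/2 / dist ?p ?q) \<le> geometric_dilation ?C" using ne by simp
qed

section \<open>Perimeter versus the distance of antipodal points\<close>

text \<open>The chain of the points \<open>d (\<tau> j)\<close> makes half a turn outside the open
  disc of radius \<open>h\<close>. Its length is at most \<open>L\<close>, since \<open>d\<close> is
  the difference of two unit-speed motions over time \<open>L/2\<close>.\<close>

lemma perimeter_ge_halving_distance:
  assumes h: "h > 0" and far: "\<And>t. t \<in> {0..L/2} \<Longrightarrow> h \<le> dist (c t) (c (t + L/2))"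
  shows "2 * h * (real n * tan (pi / (2 * real n))) \<le> L"
proof -
  define d where "d t = c t - c (t + L/2)" for t
  \<comment> \<open>\<open>d\<close> changes direction only where \<open>c t\<close> or \<open>c (t + L/2)\<close> is a vertex. Since \<open>c 0\<close> is one,
    the \<open>n + 1\<close> numbers \<open>\<beta> i\<close> include all these parameters and both ends of \<open>{0..L/2}\<close>.\<close>
  define \<beta> where "\<beta> i = (if i = 0 then 0 else if S i \<le> L/2 then S i else S i - L/2)" for i
  define xs where "xs = sort (map \<beta> [0..<Suc n])"
  define \<tau> where "\<tau> j = xs ! j" for j
  have set_xs: "set xs = \<beta> ` {..n}"
    unfolding xs_def set_sort set_map atLeast_upt[symmetric] lessThan_Suc_atMost ..
  have len: "length xs = Suc n" by (simp add: xs_def)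
  have mono: "\<tau> i \<le> \<tau> j" if "i \<le> j" "j \<le> n" for i j
    unfolding \<tau>_def using that len by (intro sorted_nth_mono) (auto simp: xs_def)
  have \<beta>_bounds: "\<beta> i \<in> {0..L/2}" if "i \<le> n" for i
    using that L_pos S_nonneg[of i] S_le_iff[of i n] by (auto simp: \<beta>_def L_def)
  have \<tau>_bounds: "\<tau> j \<in> {0..L/2}" if "j \<le> n" for j
    using \<beta>_bounds nth_mem[of j xs] that len set_xs by (auto simp: \<tau>_def)
  have \<beta>_in: "\<exists>k\<le>n. \<tau> k = \<beta> i" if "i \<le> n" for i
    using that set_xs len in_set_conv_nth[of "\<beta> i" xs] by (auto simp: \<tau>_def less_Suc_eq_le)
  have "\<beta> 0 = 0" "\<beta> n = L/2" using n3 L_pos by (auto simp: \<beta>_def L_def)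
  then have \<tau>0: "\<tau> 0 = 0" and \<tau>n: "\<tau> n = L/2"
    using \<beta>_in[of 0] \<beta>_in[of n] mono[of 0] mono[of _ n] \<tau>_bounds[of 0] \<tau>_bounds[of n] by fastforce+
  have gap: "\<not> (\<tau> j < \<beta> i \<and> \<beta> i < \<tau> (Suc j))" if ij: "i \<le> n" "j < n" for i j
  proof -
    obtain k where "k \<le> n" "\<tau> k = \<beta> i" using \<beta>_in ij by blast
    then show ?thesis using mono[of k j] mono[of "Suc j" k] ij by (cases "k \<le> j") auto
  qed
  have piece: "\<exists>i k. {\<tau> j, \<tau> (Suc j)} \<subseteq> {S i..S (Suc i)}
      \<and> {\<tau> j + L/2, \<tau> (Suc j) + L/2} \<subseteq> {S k..S (Suc k)}" if j: "j < n" for j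
  proof -
    have b: "0 \<le> \<tau> j" "\<tau> j \<le> \<tau> (Suc j)" "\<tau> (Suc j) \<le> L/2"
      using \<tau>_bounds[of j] \<tau>_bounds[of "Suc j"] mono[of j "Suc j"] j by auto
    \<comment> \<open>Such a vertex parameter is below \<open>L/2\<close>, so it equals
      \<open>\<beta> i\<close>.\<close>
    have "\<not> (\<tau> j < S i \<and> S i < \<tau> (Suc j))" if "i \<le> n" for i
      using gap[OF that j] b by (auto simp: \<beta>_def S_0 split: if_splits)
    then obtain i where i: "{\<tau> j, \<tau> (Suc j)} \<subseteq> {S i..S (Suc i)}"
      using common_piece[of "\<tau> j" "\<tau> (Suc j)"] b L_pos by auto
    \<comment> \<open>Here \<open>S i\<close> exceeds \<open>L/2\<close>, so
      \<open>S i - L/2\<close> is \<open>\<beta> i\<close> and would lie in the gap.\<close>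
    have "\<not> (\<tau> j + L/2 < S i \<and> S i < \<tau> (Suc j) + L/2)" if "i \<le> n" for i
      using gap[OF that j] b L_pos by (auto simp: \<beta>_def S_0 split: if_splits)
    then obtain k where "{\<tau> j + L/2, \<tau> (Suc j) + L/2} \<subseteq> {S k..S (Suc k)}"
      using common_piece[of "\<tau> j + L/2" "\<tau> (Suc j) + L/2"] b L_pos by auto
    with i show ?thesis by blast
  qed
  have "2 * h * (real n * tan (pi / (2 * real n))) \<le> (\<Sum>j<n. dist (d (\<tau> j)) (d (\<tau> (Suc j))))"
  proof (rule half_turn_length_ge_real2[OF _ h])
    show "n \<ge> 2" using n3 by simp
    have "c L = c 0" using c_S[of n] c_S[of 0] by (simp add: L_def S_0 w_eq_iff)
    then show "d (\<tau> n) = - d (\<tau> 0)" by (simp add: \<tau>0 \<tau>n d_def)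
  next
    fix j x assume j: "j < n" and "x \<in> closed_segment (d (\<tau> j)) (d (\<tau> (Suc j)))"
    then obtain u where u: "0 \<le> u" "u \<le> 1" "x = (1 - u) *\<^sub>R d (\<tau> j) + u *\<^sub>R d (\<tau> (Suc j))"
      by (auto simp: closed_segment_def)
    obtain i k where ik: "{\<tau> j, \<tau> (Suc j)} \<subseteq> {S i..S (Suc i)}"
      "{\<tau> j + L/2, \<tau> (Suc j) + L/2} \<subseteq> {S k..S (Suc k)}" using piece[OF j] by blast
    \<comment> \<open>Both \<open>c\<close> and its shift by \<open>L/2\<close> are affine on this
      parameter interval, so \<open>x\<close> is the value of \<open>d\<close> at the same convex
      combination of the parameters.\<close>
    define t where "t = (1 - u) * \<tau> j + u * \<tau> (Suc j)"
    have "(1 - u) * (\<tau> j + L/2) + u * (\<tau> (Suc j) + L/2) = t + L/2"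
      by (simp add: t_def field_simps)
    then have "c (t + L/2) = (1 - u) *\<^sub>R c (\<tau> j + L/2) + u *\<^sub>R c (\<tau> (Suc j) + L/2)"
      using c_piece_affine[of "\<tau> j + L/2" k "\<tau> (Suc j) + L/2" u] ik u by simp
    moreover have "c t = (1 - u) *\<^sub>R c (\<tau> j) + u *\<^sub>R c (\<tau> (Suc j))"
      unfolding t_def using ik u by (intro c_piece_affine[of _ i]) auto
    ultimately have "x = d t"
      unfolding u(3) d_def by (simp add: scaleR_diff_right)
    moreover have "t \<in> {0..L/2}"
      using convexD_alt[OF convex_real_interval(5) \<tau>_bounds[of j] \<tau>_bounds[of "Suc j"], of u] j u
      by (simp add: t_def)
    ultimately show "h \<le> norm x" using far[of t] by (simp add: d_def dist_norm)
  qed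
  also have "\<dots> \<le> (\<Sum>j<n. 2 * (\<tau> (Suc j) - \<tau> j))"
  proof (rule sum_mono)
    fix j assume "j \<in> {..<n}"
    then have j: "j < n" by simp
    obtain i k where ik: "{\<tau> j, \<tau> (Suc j)} \<subseteq> {S i..S (Suc i)}"
      "{\<tau> j + L/2, \<tau> (Suc j) + L/2} \<subseteq> {S k..S (Suc k)}" using piece[OF j] by blast
    have "dist (d (\<tau> j)) (d (\<tau> (Suc j)))
        \<le> dist (c (\<tau> j)) (c (\<tau> (Suc j))) + dist (c (\<tau> j + L/2)) (c (\<tau> (Suc j) + L/2))"
      using norm_triangle_ineq4[of "c (\<tau> j) - c (\<tau> (Suc j))" "c (\<tau> j + L/2) - c (\<tau> (Suc j) + L/2)"]
      by (simp add: d_def dist_norm algebra_simps)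
    also have "\<dots> = 2 * (\<tau> (Suc j) - \<tau> j)"
      using dist_c_piece[of "\<tau> j" i "\<tau> (Suc j)"] dist_c_piece[of "\<tau> j + L/2" k "\<tau> (Suc j) + L/2"]
        ik mono[of j "Suc j"] j by simp
    finally show "dist (d (\<tau> j)) (d (\<tau> (Suc j))) \<le> 2 * (\<tau> (Suc j) - \<tau> j)" .
  qed
  also have "\<dots> = 2 * (\<tau> n - \<tau> 0)"
    unfolding sum_distrib_left[symmetric] sum_lessThan_telescope ..
  also have "\<dots> = L" by (simp add: \<tau>0 \<tau>n)
  finally show ?thesis .
qed

text \<open>A dilation below the bound would be a real number \<open>r\<close>, positive by the
  quotient at \<open>t = 0\<close>. All antipodal distances are then at least
  \<open>L/2 / r\<close>, which serves as the radius \<open>h\<close> in place of an attained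
  minimum.\<close>

lemma dilation_ge: "geometric_dilation (polygon_curve n v) \<ge> ereal (real n * tan (pi / (2 * real n)))"
proof (rule ccontr)
  let ?D = "geometric_dilation (polygon_curve n v)" and ?K = "real n * tan (pi / (2 * real n))"
  note quot = antipodal_quotient_le_dilation
  assume "\<not> ?thesis"
  then have less: "?D < ereal ?K" by simp
  have ge: "ereal (L/2 / dist (c 0) (c (0 + L/2))) \<le> ?D" using quot(1)[of 0] L_pos by simp
  obtain r where r: "?D = ereal r" using less ge by (cases ?D) auto
  have r_lt: "r < ?K" using less r by simp
  have "L/2 / dist (c 0) (c (0 + L/2)) \<le> r" using ge r by simp
  moreover have "L/2 / dist (c 0) (c (0 + L/2)) > 0" using L_pos quot(2)[of 0] by simp
  ultimately have "r > 0" by linarith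
  have "2 * (L/2 / r) * ?K \<le> L"
  proof (rule perimeter_ge_halving_distance)
    show "L/2 / r > 0" using L_pos \<open>r > 0\<close> by simp
    fix t assume t: "t \<in> {0..L/2}"
    show "L/2 / r \<le> dist (c t) (c (t + L/2))"
      using quot(1)[OF t] quot(2)[OF t] r \<open>r > 0\<close> by (simp add: field_simps)
  qed
  then have "?K \<le> r" using L_pos \<open>r > 0\<close> by (simp add: field_simps)
  with r_lt show False by simp
qed

end

theorem corollary2:
  fixes n :: nat and v :: "nat \<Rightarrow> real^2"
  assumes "simple_polygon n v"
  shows "geometric_dilation (polygon_curve n v) \<ge> ereal (real n * tan (pi / (2 * real n)))"
  using simple_polygon_param.dilation_ge[OF simple_polygon_param.intro[OF assms]] .

end
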